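(* Let $k\ge1$ and $n\ge1$ be integers. For every $t\ge0$, $$G_I(n;k,kt)=e^{kt}\,\mathrm{Prob}\left(\lambda_{\min}\ge t\right),$$ where $\lambda_{\min}$ is the smallest eigenvalue in the Laguerre ensemble of $k\times k$ matrices associated with the weight function $x^n e^{-x}$.
   Context: A word of length $N$ from an alphabet of $k$ letters is a function $w:\{1,\dots,N\}\to\{1,\dots,k\}$; each of the $k^N$ words of length $N$ is given probability $k^{-N}$, and $\mathrm{Prob}_k$ denotes this uniform probability. $\ell_N^I(w)$ is the length of the longest weakly increasing subsequence of $w$, i.e. the largest $m$ for which there are indices $i_1<\dots<i_m$ with $w(i_1)\le\dots\le w(i_m)$. For $N=0$ there is one (empty) word, with length $0$. Set $$F_I(n;k,N)=\mathrm{Prob}_k(\ell_N^I(w)\le n),\qquad G_I(n;k,t)=\sum_{N=0}^\infty F_I(n;k,N)\frac{t^N}{N!}.$$ The Laguerre ensemble of $k\times k$ matrices associated with the weight $x^ne^{-x}$ is the (unitary, $\beta=2$) ensemble whose eigenvalues $(x_1,\dots,x_k)\in(0,\infty)^k$ have joint probability density $$c_{k,n}\prod_{j=1}^k x_j^n\,e^{-x_j}\prod_{1\le i<j\le k}(x_i-x_j)^2,$$ with $c_{k,n}$ the normalization constant making the total mass $1$. Thus $$\mathrm{Prob}(\lambda_{\min}\ge t)=c_{k,n}\int_t^\infty\cdots\int_t^\infty\prod_{j}x_j^n\,e^{-\sum_j x_j}\prod_{i<j}(x_i-x_j)^2\,dx_1\cdots dx_k.$$ *)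

theory Defs
  imports "HOL-Probability.Probability"
begin

definition words :: "nat \<Rightarrow> nat \<Rightarrow> (nat \<Rightarrow> nat) set" where
  "words k N = {1..N} \<rightarrow>\<^sub>E {1..k}"

definition weak_incr_lengths :: "nat \<Rightarrow> (nat \<Rightarrow> nat) \<Rightarrow> nat set" where
  "weak_incr_lengths N w =
     {m. \<exists>i. i \<in> {1..m} \<rightarrow> {1..N} \<and> strict_mono_on {1..m} i \<and> mono_on {1..m} (w \<circ> i)}"

definition longest_weak_incr :: "nat \<Rightarrow> (nat \<Rightarrow> nat) \<Rightarrow> nat" where
  "longest_weak_incr N w = Max (weak_incr_lengths N w)"

lemma zero_in_weak_incr_lengths: "0 \<in> weak_incr_lengths N w"
  by (auto simp: weak_incr_lengths_def monotone_on_def)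

lemma weak_incr_lengths_le:
  assumes "m \<in> weak_incr_lengths N w"
  shows "m \<le> N"
proof -
  from assms obtain i where i: "i \<in> {1..m} \<rightarrow> {1..N}" "strict_mono_on {1..m} i"
    by (auto simp: weak_incr_lengths_def)
  have "card {1..m} \<le> card {1..N}"
    using i by (intro card_inj_on_le[where f = i]) (auto dest: strict_mono_on_imp_inj_on)
  then show ?thesis by simp
qed

lemma finite_weak_incr_lengths: "finite (weak_incr_lengths N w)"
  by (rule finite_subset[of _ "{..N}"]) (auto dest: weak_incr_lengths_le)

definition F_I :: "nat \<Rightarrow> nat \<Rightarrow> nat \<Rightarrow> real" where
  "F_I n k N = \<P>(w in measure_pmf (pmf_of_set (words k N)). longest_weak_incr N w \<le> n)"

definition G_I :: "nat \<Rightarrow> nat \<Rightarrow> real \<Rightarrow> real" where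
  "G_I n k t = (\<Sum>N. F_I n k N * t ^ N / fact N)"

lemma summable_G_I: "summable (\<lambda>N. F_I n k N * t ^ N / fact N)"
proof (rule summable_comparison_test')
  show "summable (\<lambda>N. inverse (fact N) * \<bar>t\<bar> ^ N)"
    by (rule summable_exp)
  fix N :: nat
  have "F_I n k N * (\<bar>t\<bar> ^ N / fact N) \<le> 1 * (\<bar>t\<bar> ^ N / fact N)"
    unfolding F_I_def by (intro mult_right_mono measure_pmf.prob_le_1) auto
  moreover have "0 \<le> F_I n k N"
    by (simp add: F_I_def)
  ultimately show "norm (F_I n k N * t ^ N / fact N) \<le> inverse (fact N) * \<bar>t\<bar> ^ N"
    by (simp add: abs_mult power_abs field_simps)
qed

text \<open>
  The ensemble is represented by its joint eigenvalue law on \<open>(0,\<infinity>)\<^sup>k\<close>; a configuration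
  is a function on \<open>{1..k}\<close>, and the ambient measure is Lebesgue measure on the product space.
\<close>

definition laguerre_weight :: "nat \<Rightarrow> nat \<Rightarrow> (nat \<Rightarrow> real) \<Rightarrow> real" where
  "laguerre_weight k n x =
     (\<Prod>j\<in>{1..k}. indicator {0<..} (x j) * x j ^ n * exp (- x j)) *
     (\<Prod>i\<in>{1..k}. \<Prod>j\<in>{i<..k}. (x i - x j)\<^sup>2)"

definition laguerre_const :: "nat \<Rightarrow> nat \<Rightarrow> real" where
  "laguerre_const k n =
     1 / (LINT x|(\<Pi>\<^sub>M j\<in>{1..k}. lborel). laguerre_weight k n x)"

definition laguerre_ensemble :: "nat \<Rightarrow> nat \<Rightarrow> (nat \<Rightarrow> real) measure" where
  "laguerre_ensemble k n =
     density (\<Pi>\<^sub>M j\<in>{1..k}. lborel)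
       (\<lambda>x. ennreal (laguerre_const k n * laguerre_weight k n x))"

definition lambda_min :: "nat \<Rightarrow> (nat \<Rightarrow> real) \<Rightarrow> real" where
  "lambda_min k x = Min (x ` {1..k})"

end

theory Submission
  imports Defs "Jordan_Normal_Form.Determinant" "HOL-Library.Sublist"
begin

text \<open>
  After the substitution \<open>t \<mapsto> kt\<close> the left hand side is the exponential generating function
  \<open>\<Sum>\<^sub>N a\<^sub>N t^N / N!\<close>, where \<open>a\<^sub>N\<close> counts the words of length \<open>N\<close> without a weakly increasing
  subsequence of length \<open>n + 1\<close>. It is computed without the Robinson-Schensted correspondence, by
  reading words letter by letter.

  Number the letters \<open>0, \<dots>, k - 1\<close> in reverse order, so that the subsequences in question are the
  weakly decreasing ones. What may still follow a given prefix is described by a budget \<open>e\<^sub>c\<close> for each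
  letter \<open>c\<close>: every weakly decreasing subsequence of the rest that starts with \<open>c\<close> must have length
  less than \<open>e\<^sub>c\<close>. These budgets increase with \<open>c\<close>, and reading \<open>c\<close> lowers \<open>e\<^sub>c\<close> by one and pushes
  every \<open>e\<^sub>m\<close> with \<open>m < c\<close> down to the new \<open>e\<^sub>c\<close> if it exceeds it (\<open>admissible_Cons\<close>). Hence the generating
  functions \<open>P\<^sub>e\<close> of the admissible words satisfy \<open>P\<^sub>e(0) = 1\<close> and \<open>P\<^sub>e' = \<Sum>\<^sub>c P\<^bsub>push c e\<^esub>\<close>,
  with \<open>P\<^sub>e\<close> replaced by \<open>0\<close> once some budget is exhausted.

  This system is solved by the determinant \<open>P\<^sub>e = det (\<Delta>^j M\<^sub>i(e\<^sub>j))\<close>, where \<open>\<Delta>\<close> is the forward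
  difference and \<open>M\<^sub>i(0) = 0\<close>,
  \<open>M\<^sub>i(x + 1) = \<integral>\<^sub>0\<^sup>\<infinity> (y + t)^x / x! * y^i / i! * exp (- y) dy\<close>. Since \<open>\<partial>M\<^sub>i(x + 1)/\<partial>t = M\<^sub>i(x)\<close>,
  differentiation lowers one budget at a time. If this breaks the order, so that
  \<open>e\<^sub>j = e\<^bsub>j+1\<^esub> + 1\<close>, then column \<open>j\<close> at \<open>e\<^sub>j\<close> is column \<open>j\<close> at \<open>e\<^sub>j - 1\<close> plus column \<open>j + 1\<close>,
  and the determinant does not change when \<open>e\<^sub>j\<close> is lowered too: the determinant performs the
  pushing by itself (\<open>word_poly_drag\<close>, \<open>coeff_word_poly\<close>).

  For the constant budget \<open>n + 1\<close> the entries of the determinant are, after the shift \<open>x = y + t\<close>,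
  integrals over \<open>[t, \<infinity>)\<close> of \<open>(x - t)^i\<close> times \<open>x^n * exp (- x)\<close> times a polynomial in \<open>x\<close> of
  degree \<open>j\<close>. Andreief's identity turns such a determinant into a \<open>k\<close>-fold integral of a product
  of two determinants, each of which is a constant multiple of the Vandermonde determinant. This is
  the Laguerre integral over \<open>[t, \<infinity>)\<^sup>k\<close> (\<open>laguerre_tail_integral\<close>); the value \<open>P\<^sub>e(0) = 1\<close>
  identifies the normalization constant, so that no Selberg integral has to be evaluated.
\<close>

section \<open>Determinants of square arrays and Andreief's identity\<close>

definition det_of :: "nat \<Rightarrow> (nat \<Rightarrow> nat \<Rightarrow> 'a) \<Rightarrow> 'a::comm_ring_1" where
  "det_of k f = det (mat k k (\<lambda>(i, j). f i j))"

lemma det_of_leibniz_rows: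
  "det_of k f = (\<Sum>p | p permutes {..<k}. of_int (sign p) * (\<Prod>i<k. f i (p i)))"
  unfolding det_of_def
  by (subst det_def'[where n = k])
     (auto simp: atLeast0LessThan intro!: sum.cong prod.cong dest!: permutes_in_image)

lemma det_of_leibniz_cols:
  "det_of k f = (\<Sum>p | p permutes {..<k}. of_int (sign p) * (\<Prod>j<k. f (p j) j))"
  unfolding det_of_def
  by (subst det_col[where n = k])
     (auto simp: atLeast0LessThan intro!: sum.cong prod.cong dest!: permutes_in_image)

lemma det_of_cong:
  assumes "\<And>i j. i < k \<Longrightarrow> j < k \<Longrightarrow> f i j = g i j"
  shows "det_of k f = det_of k g"
  unfolding det_of_def by (rule arg_cong[of _ _ det]) (auto intro!: eq_matI assms)

lemma det_of_hom:
  assumes "comm_ring_hom h"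
  shows "h (det_of k f) = det_of k (\<lambda>i j. h (f i j))"
proof -
  interpret comm_ring_hom h by fact
  have "map_mat h (mat k k (\<lambda>(i, j). f i j)) = mat k k (\<lambda>(i, j). h (f i j))"
    by (auto intro!: eq_matI)
  then show ?thesis unfolding det_of_def by (metis hom_det)
qed

lemma det_of_mult:
  "det_of k f * det_of k g = det_of k (\<lambda>i j. \<Sum>m<k. f i m * g m j)"
proof -
  have "mat k k (\<lambda>(i, j). f i j) * mat k k (\<lambda>(i, j). g i j)
      = mat k k (\<lambda>(i, j). \<Sum>m<k. f i m * g m j)"
    by (auto intro!: eq_matI sum.cong simp: scalar_prod_def atLeast0LessThan)
  then show ?thesis
    unfolding det_of_def by (subst det_mult[where n = k, symmetric]) auto
qed

lemma det_of_lower_triangular: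
  assumes "\<And>i j. i < j \<Longrightarrow> j < k \<Longrightarrow> f i j = 0"
  shows "det_of k f = (\<Prod>i<k. f i i)"
  unfolding det_of_def
  by (subst det_lower_triangular[where n = k])
     (auto simp: assms diag_mat_def prod.list_conv_set_nth intro!: prod.cong
           simp: atLeast0LessThan)

lemma det_of_upper_triangular:
  assumes "\<And>i j. j < i \<Longrightarrow> i < k \<Longrightarrow> f i j = 0"
  shows "det_of k f = (\<Prod>i<k. f i i)"
  unfolding det_of_def
  by (subst det_upper_triangular[where n = k])
     (auto simp: assms diag_mat_def prod.list_conv_set_nth intro!: prod.cong
           simp: atLeast0LessThan upper_triangular_def)

lemma det_of_scale_rows: "det_of k (\<lambda>i j. a i * f i j) = (\<Prod>i<k. a i) * det_of k f"
  unfolding det_of_leibniz_rows by (simp add: prod.distrib sum_distrib_left mult_ac)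

lemma det_of_identical_columns:
  assumes "a < k" "b < k" "a \<noteq> b" "\<And>i. i < k \<Longrightarrow> f i a = f i b"
  shows "det_of k f = 0"
  unfolding det_of_def
  by (rule Determinant.det_identical_columns[where n = k and i = a and j = b])
     (use assms in \<open>auto intro!: eq_vecI\<close>)

lemma det_of_zero_column:
  assumes "c < k" "\<And>i. i < k \<Longrightarrow> f i c = 0"
  shows "det_of k f = 0"
  unfolding det_of_leibniz_cols
proof (intro sum.neutral ballI)
  fix p assume "p \<in> {p. p permutes {..<k}}"
  then have "p c < k" using assms(1) by (auto dest: permutes_in_image)
  then have "(\<Prod>j<k. f (p j) j) = 0"
    using assms by (intro prod_zero) auto
  then show "of_int (sign p) * (\<Prod>j<k. f (p j) j) = 0" by simp
qed

lemma det_of_add_column: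
  assumes "c < k"
    and "\<And>i. i < k \<Longrightarrow> f i c = g i c + h i c"
    and "\<And>i j. i < k \<Longrightarrow> j < k \<Longrightarrow> j \<noteq> c \<Longrightarrow> g i j = f i j \<and> h i j = f i j"
  shows "det_of k f = det_of k g + det_of k h"
  unfolding det_of_leibniz_cols sum.distrib[symmetric]
proof (intro sum.cong refl)
  fix p assume p: "p \<in> {p. p permutes {..<k}}"
  have pk: "p j < k" if "j < k" for j using p that by (auto dest: permutes_in_image)
  have split: "(\<Prod>j<k. F (p j) j) = F (p c) c * (\<Prod>j\<in>{..<k} - {c}. F (p j) j)"
    for F :: "nat \<Rightarrow> nat \<Rightarrow> 'a"
    using assms(1) by (intro prod.remove) auto
  have "(\<Prod>j\<in>{..<k} - {c}. g (p j) j) = (\<Prod>j\<in>{..<k} - {c}. f (p j) j)"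
       "(\<Prod>j\<in>{..<k} - {c}. h (p j) j) = (\<Prod>j\<in>{..<k} - {c}. f (p j) j)"
    using assms(3) pk by (auto intro!: prod.cong)
  then show "of_int (sign p) * (\<Prod>j<k. f (p j) j) =
      of_int (sign p) * (\<Prod>j<k. g (p j) j) + of_int (sign p) * (\<Prod>j<k. h (p j) j)"
    unfolding split using assms(2)[OF pk[OF assms(1)]] by (simp add: algebra_simps)
qed

lemma pderiv_det_of:
  fixes f :: "nat \<Rightarrow> nat \<Rightarrow> real poly"
  shows "pderiv (det_of k f) = (\<Sum>c<k. det_of k (\<lambda>i j. if j = c then pderiv (f i j) else f i j))"
proof -
  have sgn: "pderiv (of_int z * q) = of_int z * pderiv q" for z :: int and q :: "real poly"
    by (simp add: of_int_poly pderiv_smult)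
  have "pderiv (det_of k f) =
      (\<Sum>p | p permutes {..<k}. \<Sum>c<k. of_int (sign p) *
         (\<Prod>j<k. if j = c then pderiv (f (p j) j) else f (p j) j))"
    unfolding det_of_leibniz_cols higher_pderiv_sum[of 1, simplified]
  proof (intro sum.cong refl)
    fix p
    have "(\<Prod>j<k. if j = c then pderiv (f (p j) j) else f (p j) j) =
        (\<Prod>j\<in>{..<k} - {c}. f (p j) j) * pderiv (f (p c) c)" if "c < k" for c
      using that by (subst prod.remove[of _ c]) (auto simp: mult.commute intro!: prod.cong)
    then show "pderiv (of_int (sign p) * (\<Prod>j<k. f (p j) j)) = (\<Sum>c<k. of_int (sign p) *
         (\<Prod>j<k. if j = c then pderiv (f (p j) j) else f (p j) j))"
      by (simp add: sgn pderiv_prod sum_distrib_left)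
  qed
  also have "\<dots> = (\<Sum>c<k. det_of k (\<lambda>i j. if j = c then pderiv (f i j) else f i j))"
    unfolding det_of_leibniz_cols by (rule sum.swap)
  finally show ?thesis .
qed

text \<open>
  The matrix factors as the Vandermonde matrix times the matrix of coefficients, and the latter is
  upper triangular by the degree bounds.
\<close>

lemma det_of_polynomials:
  fixes q :: "nat \<Rightarrow> real poly"
  assumes "\<And>j. j < k \<Longrightarrow> degree (q j) \<le> j"
  shows "det_of k (\<lambda>i j. poly (q j) (x i)) =
    det_of k (\<lambda>i j. x i ^ j) * (\<Prod>j<k. coeff (q j) j)"
proof -
  have "det_of k (\<lambda>m j. coeff (q j) m) = (\<Prod>j<k. coeff (q j) j)"
  proof (rule det_of_upper_triangular)
    fix i j assume "j < i" "i < k"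
    then show "coeff (q j) i = 0"
      using assms[of j] by (intro coeff_eq_0) linarith
  qed
  then have "det_of k (\<lambda>i j. x i ^ j) * (\<Prod>j<k. coeff (q j) j) =
      det_of k (\<lambda>i j. x i ^ j) * det_of k (\<lambda>m j. coeff (q j) m)"
    by simp
  also have "\<dots> = det_of k (\<lambda>i j. \<Sum>m<k. x i ^ m * coeff (q j) m)"
    by (rule det_of_mult)
  also have "\<dots> = det_of k (\<lambda>i j. poly (q j) (x i))"
  proof (rule det_of_cong)
    fix i j assume "i < k" "j < k"
    have "poly (q j) (x i) = (\<Sum>m\<le>degree (q j). coeff (q j) m * x i ^ m)"
      by (rule poly_altdef)
    also have "\<dots> = (\<Sum>m<k. coeff (q j) m * x i ^ m)"
      using assms[of j] \<open>j < k\<close> by (intro sum.mono_neutral_left) (auto simp: coeff_eq_0)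
    finally show "(\<Sum>m<k. x i ^ m * coeff (q j) m) = poly (q j) (x i)"
      by (simp add: mult.commute)
  qed
  finally show ?thesis ..
qed

text \<open>
  Evaluate the determinant in the Newton basis \<open>q\<^sub>j(z) = \<Prod>\<^bsub>i<j\<^esub> (z - x\<^sub>i)\<close> instead: these polynomials
  are monic of degree \<open>j\<close>, so the determinant stays the same, but \<open>q\<^sub>j(x\<^sub>i) = 0\<close> for \<open>i < j\<close> makes
  the matrix triangular.
\<close>

lemma vandermonde:
  fixes x :: "nat \<Rightarrow> real"
  shows "det_of k (\<lambda>i j. x i ^ j) = (\<Prod>i<k. \<Prod>j<i. x i - x j)"
proof -
  define q where "q j = (\<Prod>i<j. [:- x i, 1:])" for j
  have deg: "degree (q j) = j" for j
    unfolding q_def by (subst degree_prod_eq_sum_degree) auto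
  have "lead_coeff (q j) = 1" for j
    unfolding q_def lead_coeff_prod by simp
  then have "det_of k (\<lambda>i j. x i ^ j) = det_of k (\<lambda>i j. poly (q j) (x i))"
    using deg by (subst det_of_polynomials) auto
  also have "\<dots> = (\<Prod>i<k. poly (q i) (x i))"
    by (rule det_of_lower_triangular) (auto simp: q_def poly_prod)
  finally show ?thesis by (simp add: q_def poly_prod)
qed

text \<open>
  Andreief's identity. Expand both determinants over permutations \<open>s\<close> and \<open>t\<close>; by Fubini every
  term becomes a product of one-dimensional integrals. For each fixed \<open>t\<close>, the sum over \<open>s\<close>
  is again the determinant of these integrals, with rows and columns rearranged by \<open>t\<close>, and there
  are \<open>k!\<close> choices of \<open>t\<close>. The variables carry the indices \<open>1, \<dots>, k\<close> of the ensemble, whereas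
  rows and columns are counted from \<open>0\<close>.
\<close>

lemma andreief:
  fixes f g :: "nat \<Rightarrow> real \<Rightarrow> real"
  assumes "sigma_finite_measure M"
    and int: "\<And>i j. i < k \<Longrightarrow> j < k \<Longrightarrow> integrable M (\<lambda>x. f i x * g j x)"
  shows "has_bochner_integral (\<Pi>\<^sub>M j\<in>{1..k}. M)
    (\<lambda>x. det_of k (\<lambda>l i. f i (x (Suc l))) * det_of k (\<lambda>l j. g j (x (Suc l))))
    (fact k * det_of k (\<lambda>i j. LINT x|M. f i x * g j x))"
proof -
  interpret sigma_finite_measure M by fact
  interpret product_sigma_finite "\<lambda>_::nat. M"
    unfolding product_sigma_finite_def using assms(1) by simp
  define P where "P = {p. p permutes {..<k}}"
  define m where "m i j = (LINT x|M. f i x * g j x)" for i j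
  have Pk: "p l < k" if "p \<in> P" "l < k" for p l
    using that unfolding P_def by (auto dest: permutes_in_image)
  have "has_bochner_integral (\<Pi>\<^sub>M j\<in>{1..k}. M)
      (\<lambda>x. \<Sum>t\<in>P. \<Sum>s\<in>P. of_int (sign s * sign t) *
         (\<Prod>l\<in>{1..k}. f (s (l - 1)) (x l) * g (t (l - 1)) (x l)))
      (\<Sum>t\<in>P. \<Sum>s\<in>P. of_int (sign s * sign t) * (\<Prod>l\<in>{1..k}. m (s (l - 1)) (t (l - 1))))"
  proof (intro has_bochner_integral_sum has_bochner_integral_mult_right)
    fix s t assume st: "t \<in> P" "s \<in> P"
    have int': "integrable M (\<lambda>y. f (s (l - 1)) y * g (t (l - 1)) y)" if "l \<in> {1..k}" for l
      by (rule int; rule Pk) (use that st in auto)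
    show "has_bochner_integral (\<Pi>\<^sub>M j\<in>{1..k}. M)
        (\<lambda>x. \<Prod>l\<in>{1..k}. f (s (l - 1)) (x l) * g (t (l - 1)) (x l))
        (\<Prod>l\<in>{1..k}. m (s (l - 1)) (t (l - 1)))"
      unfolding has_bochner_integral_iff m_def
    proof (rule conjI)
      show "integrable (\<Pi>\<^sub>M j\<in>{1..k}. M)
          (\<lambda>x. \<Prod>l\<in>{1..k}. f (s (l - 1)) (x l) * g (t (l - 1)) (x l))"
        by (rule product_integrable_prod) (use int' in blast)+
      show "(LINT x|(\<Pi>\<^sub>M j\<in>{1..k}. M). (\<Prod>l\<in>{1..k}. f (s (l - 1)) (x l) * g (t (l - 1)) (x l))) =
          (\<Prod>l\<in>{1..k}. LINT x|M. f (s (l - 1)) x * g (t (l - 1)) x)"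
        by (rule product_integral_prod) (use int' in blast)+
    qed
  qed
  also have "(\<lambda>x. \<Sum>t\<in>P. \<Sum>s\<in>P. of_int (sign s * sign t) *
         (\<Prod>l\<in>{1..k}. f (s (l - 1)) (x l) * g (t (l - 1)) (x l))) =
      (\<lambda>x. det_of k (\<lambda>l i. f i (x (Suc l))) * det_of k (\<lambda>l j. g j (x (Suc l))))"
  proof
    fix x :: "nat \<Rightarrow> real"
    have "det_of k (\<lambda>l i. f i (x (Suc l))) * det_of k (\<lambda>l j. g j (x (Suc l))) =
        (\<Sum>s\<in>P. \<Sum>t\<in>P. of_int (sign s * sign t) *
           (\<Prod>l\<in>{1..k}. f (s (l - 1)) (x l) * g (t (l - 1)) (x l)))"
      unfolding det_of_leibniz_rows P_def[symmetric] sum_product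
      by (intro sum.cong refl) (simp add: prod.atLeast1_atMost_eq prod.distrib)
    also have "\<dots> = (\<Sum>t\<in>P. \<Sum>s\<in>P. of_int (sign s * sign t) *
           (\<Prod>l\<in>{1..k}. f (s (l - 1)) (x l) * g (t (l - 1)) (x l)))"
      by (rule sum.swap)
    finally show "(\<Sum>t\<in>P. \<Sum>s\<in>P. of_int (sign s * sign t) *
           (\<Prod>l\<in>{1..k}. f (s (l - 1)) (x l) * g (t (l - 1)) (x l))) =
        det_of k (\<lambda>l i. f i (x (Suc l))) * det_of k (\<lambda>l j. g j (x (Suc l)))" ..
  qed
  also have "(\<Sum>t\<in>P. \<Sum>s\<in>P. of_int (sign s * sign t) * (\<Prod>l\<in>{1..k}. m (s (l - 1)) (t (l - 1))))
      = (\<Sum>t\<in>P. det_of k m)"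
  proof (intro sum.cong refl)
    fix t assume t: "t \<in> P"
    then have tp: "t permutes {..<k}" by (simp add: P_def)
    \<comment> \<open>replace the summation variable \<open>s\<close> by \<open>s \<circ> t\<close>\<close>
    have "(\<Sum>s\<in>P. of_int (sign s * sign t) * (\<Prod>l\<in>{1..k}. m (s (l - 1)) (t (l - 1)))) =
        (\<Sum>s\<in>P. of_int (sign (s \<circ> t) * sign t) * (\<Prod>l<k. m ((s \<circ> t) l) (t l)))"
      using sum_permutations_compose_right[OF tp,
          of "\<lambda>s. of_int (sign s * sign t) * (\<Prod>l<k. m (s l) (t l))"]
      by (simp add: P_def prod.atLeast1_atMost_eq)
    also have "\<dots> = det_of k m"
      unfolding det_of_leibniz_cols P_def[symmetric]
    proof (intro sum.cong refl)
      fix s assume "s \<in> P"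
      then have sp: "s permutes {..<k}" by (simp add: P_def)
      have "sign (s \<circ> t) = sign s * sign t"
        using sp tp by (intro sign_compose permutes_imp_permutation) auto
      moreover have "(\<Prod>l<k. m ((s \<circ> t) l) (t l)) = (\<Prod>j<k. m (s j) j)"
        unfolding prod.permute[OF tp, of "\<lambda>j. m (s j) j"] comp_def ..
      ultimately show "of_int (sign (s \<circ> t) * sign t) * (\<Prod>l<k. m ((s \<circ> t) l) (t l)) =
          of_int (sign s) * (\<Prod>j<k. m (s j) j)"
        by (simp add: mult.assoc)
    qed
    finally show "(\<Sum>s\<in>P. of_int (sign s * sign t) * (\<Prod>l\<in>{1..k}. m (s (l - 1)) (t (l - 1)))) =
        det_of k m" .
  qed
  also have "\<dots> = fact k * det_of k m"
    by (simp add: P_def card_permutations[of "{..<k}" k])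
  finally show ?thesis unfolding m_def[abs_def] .
qed

section \<open>Words with bounded decreasing subsequences\<close>

text \<open>
  The strict inequality leaves room for the value \<open>e c = 0\<close>, a budget that was exhausted by its
  last letter; the budgets of interest are positive, and \<open>e c = 1\<close> forbids the letter \<open>c\<close>.
\<close>

definition admissible :: "(nat \<Rightarrow> nat) \<Rightarrow> nat list \<Rightarrow> bool" where
  "admissible e w \<longleftrightarrow>
     (\<forall>ys. subseq ys w \<and> sorted_wrt (\<ge>) ys \<and> ys \<noteq> [] \<longrightarrow> length ys < e (hd ys))"

text \<open>
  The budgets after reading the letter \<open>c\<close>. Letters \<open>m \<le> c\<close> may follow \<open>c\<close> in a weakly
  decreasing subsequence, so they also inherit the new bound of \<open>c\<close>.
\<close>

definition push :: "nat \<Rightarrow> (nat \<Rightarrow> nat) \<Rightarrow> nat \<Rightarrow> nat" where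
  "push c e = (\<lambda>m. if m \<le> c then min (e m) (e c - 1) else e m)"

definition admissible_words :: "nat \<Rightarrow> (nat \<Rightarrow> nat) \<Rightarrow> nat \<Rightarrow> nat list set" where
  "admissible_words k e N = {w. length w = N \<and> set w \<subseteq> {..<k} \<and> admissible e w}"

lemma admissible_Nil: "admissible e []"
  by (auto simp: admissible_def)

text \<open>
  A weakly decreasing subsequence of \<open>c # w\<close> either lies in \<open>w\<close> or consists of \<open>c\<close> followed by a
  (possibly empty) one in \<open>w\<close> that starts with a letter \<open>m \<le> c\<close>. The second kind imposes the
  bound \<open>e c - 1\<close> on the latter.
\<close>

lemma admissible_Cons:
  "admissible e (c # w) \<longleftrightarrow> 2 \<le> e c \<and> admissible (push c e) w"
proof
  assume L: "admissible e (c # w)"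
  have bound: "length ys < e (hd ys)"
    if "subseq ys (c # w)" "sorted_wrt (\<ge>) ys" "ys \<noteq> []" for ys
    using L that unfolding admissible_def by blast
  have "1 < e c" using bound[of "[c]"] by simp
  moreover have "length ys < push c e (hd ys)"
    if ys: "subseq ys w" "sorted_wrt (\<ge>) ys" "ys \<noteq> []" for ys
  proof -
    have "length ys < e (hd ys)" using ys by (intro bound) auto
    moreover have "length ys < e c - 1" if "hd ys \<le> c"
    proof -
      have "\<forall>y\<in>set ys. y \<le> c"
        using ys that by (cases ys) auto
      then show ?thesis
        using bound[of "c # ys"] ys by auto
    qed
    ultimately show ?thesis by (simp add: push_def)
  qed
  ultimately show "2 \<le> e c \<and> admissible (push c e) w" by (auto simp: admissible_def)
next
  assume R: "2 \<le> e c \<and> admissible (push c e) w"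
  have bound: "length ys < push c e (hd ys)"
    if "subseq ys w" "sorted_wrt (\<ge>) ys" "ys \<noteq> []" for ys
    using R that unfolding admissible_def by blast
  show "admissible e (c # w)"
    unfolding admissible_def
  proof (intro allI impI, elim conjE)
    fix ys assume ys: "subseq ys (c # w)" "sorted_wrt (\<ge>) ys" "ys \<noteq> []"
    show "length ys < e (hd ys)"
    proof (cases "subseq ys w")
      case True
      then show ?thesis using bound[of ys] ys by (auto simp: push_def split: if_splits)
    next
      case False
      then obtain zs where zs: "ys = c # zs" "subseq zs w"
        using ys(1,3) by (cases ys) (auto simp: subseq_Cons2_iff split: if_splits)
      show ?thesis
      proof (cases "zs = []")
        case True
        then show ?thesis using zs R by simp
      next
        case False
        moreover have "hd zs \<le> c" using zs ys(2) False by (cases zs) auto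
        ultimately show ?thesis
          using bound[of zs] zs ys(2) by (auto simp: push_def)
      qed
    qed
  qed
qed

lemma finite_admissible_words: "finite (admissible_words k e N)"
  unfolding admissible_words_def
  by (rule finite_subset[OF _ finite_lists_length_eq[of "{..<k}" N]]) auto

lemma card_admissible_words_0: "card (admissible_words k e 0) = 1"
proof -
  have "admissible_words k e 0 = {[]}" by (auto simp: admissible_words_def admissible_Nil)
  then show ?thesis by simp
qed

lemma card_admissible_words_Suc:
  "card (admissible_words k e (Suc N)) =
     (\<Sum>c<k. if 2 \<le> e c then card (admissible_words k (push c e) N) else 0)"
proof -
  define S where "S c = (if 2 \<le> e c then admissible_words k (push c e) N else {})" for c
  have "admissible_words k e (Suc N) = (\<Union>c<k. (#) c ` S c)"
  proof (intro equalityI subsetI)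
    fix w assume "w \<in> admissible_words k e (Suc N)"
    then show "w \<in> (\<Union>c<k. (#) c ` S c)"
      by (cases w) (auto simp: admissible_words_def S_def admissible_Cons)
  next
    fix w assume "w \<in> (\<Union>c<k. (#) c ` S c)"
    then show "w \<in> admissible_words k e (Suc N)"
      by (auto simp: admissible_words_def S_def admissible_Cons split: if_splits)
  qed
  also have "card \<dots> = (\<Sum>c<k. card ((#) c ` S c))"
    by (rule card_UN_disjoint) (auto simp: S_def finite_admissible_words)
  also have "\<dots> = (\<Sum>c<k. card (S c))"
    by (intro sum.cong refl card_image) auto
  finally show ?thesis by (simp add: S_def if_distrib cong: if_cong)
qed

section \<open>The determinant that counts admissible words\<close>

text \<open>
  The polynomials \<open>M\<^sub>p\<close> in \<open>t\<close> with the index shifted by one: the value at \<open>Suc x\<close> is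
  \<open>\<integral>\<^sub>0\<^sup>\<infinity> (y + t)^x / x! * y^p / p! * exp (- y) dy\<close>, expanded by the binomial theorem (see
  \<open>shifted_moment_integral\<close>). The value \<open>0\<close> at \<open>0\<close> is the boundary condition for an exhausted
  budget, and it also fits the rule that the derivative lowers the index.
\<close>

fun shifted_moment :: "nat \<Rightarrow> nat \<Rightarrow> real poly" where
  "shifted_moment p 0 = 0"
| "shifted_moment p (Suc x) = (\<Sum>s\<le>x. monom (of_nat ((x - s + p) choose p) / fact s) s)"

fun moment_diff :: "nat \<Rightarrow> nat \<Rightarrow> nat \<Rightarrow> real poly" where
  "moment_diff p 0 x = shifted_moment p x"
| "moment_diff p (Suc m) x = moment_diff p m (Suc x) - moment_diff p m x"

definition word_poly :: "nat \<Rightarrow> (nat \<Rightarrow> nat) \<Rightarrow> real poly" where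
  "word_poly k e = det_of k (\<lambda>i j. moment_diff i j (e j))"

lemma pderiv_shifted_moment: "pderiv (shifted_moment p (Suc x)) = shifted_moment p x"
proof (cases x)
  case 0
  then show ?thesis by (simp add: pderiv_monom)
next
  case (Suc y)
  have *: "of_nat (Suc s) * a / fact (Suc s) = a / fact s" for s and a :: real
    by (simp add: fact_Suc del: of_nat_Suc)
  show ?thesis
    unfolding Suc shifted_moment.simps sum.atMost_Suc_shift pderiv_add higher_pderiv_sum[of 1, simplified]
    by (simp add: pderiv_monom * del: of_nat_Suc fact_Suc)
qed

lemma pderiv_moment_diff: "pderiv (moment_diff p m (Suc x)) = moment_diff p m x"
  by (induction m arbitrary: x) (simp_all add: pderiv_shifted_moment pderiv_diff del: shifted_moment.simps)

text \<open>
  At \<open>t = 0\<close> the moments are the binomial coefficients \<open>x + p\<close> over \<open>p\<close>, a polynomial of degree \<open>p\<close> in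
  \<open>x\<close>; each difference lowers the degree by Pascal's rule, and more than \<open>p\<close> differences
  annihilate it.
\<close>

lemma coeff_0_moment_diff:
  "coeff (moment_diff p m (Suc x)) 0 = (if m \<le> p then of_nat ((x + p) choose (p - m)) else 0)"
proof (induction m arbitrary: x)
  case 0
  have "coeff (shifted_moment p (Suc x)) 0 =
      (\<Sum>s\<le>x. if s = 0 then of_nat ((x - s + p) choose p) / fact s else 0)"
    by (auto simp: coeff_sum intro!: sum.cong)
  also have "\<dots> = of_nat ((x + p) choose p)" by (subst sum.delta) auto
  finally show ?case by (simp del: shifted_moment.simps)
next
  case (Suc m)
  show ?case
  proof (cases "Suc m \<le> p")
    case True
    then obtain d where "p - m = Suc d" "p - Suc m = d" by (metis Suc_diff_Suc Suc_le_lessD)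
    with True Suc.IH[of x] Suc.IH[of "Suc x"] show ?thesis by simp
  next
    case False
    then have "m \<le> p \<Longrightarrow> p - m = 0" by simp
    with False Suc.IH[of x] Suc.IH[of "Suc x"] show ?thesis by auto
  qed
qed

lemma comm_ring_hom_poly: "comm_ring_hom (\<lambda>p. poly p (a::real))"
  by unfold_locales auto

text \<open>
  The initial condition: at \<open>t = 0\<close> the matrix is lower triangular with ones on the diagonal.
\<close>

lemma coeff_0_word_poly:
  assumes "\<And>j. j < k \<Longrightarrow> 1 \<le> e j"
  shows "coeff (word_poly k e) 0 = 1"
proof -
  have c: "coeff (moment_diff i j (e j)) 0 = (if j \<le> i then of_nat ((e j - 1 + i) choose (i - j)) else 0)"
    if "j < k" for i j
    using coeff_0_moment_diff[of i j "e j - 1"] assms[OF that] by simp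
  have "coeff (word_poly k e) 0 = det_of k (\<lambda>i j. coeff (moment_diff i j (e j)) 0)"
    using det_of_hom[OF comm_ring_hom_poly[of 0]] by (simp add: word_poly_def poly_0_coeff_0)
  also have "\<dots> = (\<Prod>i<k. coeff (moment_diff i i (e i)) 0)"
    by (rule det_of_lower_triangular) (simp add: c)
  also have "\<dots> = 1" by (rule prod.neutral) (simp add: c)
  finally show ?thesis .
qed

lemma pderiv_word_poly:
  assumes "\<And>j. j < k \<Longrightarrow> 1 \<le> e j"
  shows "pderiv (word_poly k e) = (\<Sum>c<k. word_poly k (e(c := e c - 1)))"
  unfolding word_poly_def pderiv_det_of
proof (intro sum.cong det_of_cong refl)
  fix c i j assume "j < k"
  then obtain x where "e j = Suc x" using assms[of j] by (cases "e j") auto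
  then show "(if j = c then pderiv (moment_diff i j (e j)) else moment_diff i j (e j)) =
      moment_diff i j ((e(c := e c - 1)) j)"
    by (auto simp: pderiv_moment_diff)
qed

text \<open>
  Budgets are increasing, so an exhausted budget always shows up at the letter \<open>0\<close>, which is the
  column without differences; there the boundary value of the moments produces a zero column.
\<close>

lemma word_poly_eq_0:
  assumes "0 < k" "e 0 = 0"
  shows "word_poly k e = 0"
  unfolding word_poly_def by (rule det_of_zero_column[of 0]) (use assms in auto)

text \<open>
  Column \<open>j\<close> at \<open>x + 1\<close> is the sum of column \<open>j\<close> at \<open>x\<close> and the \<open>(j + 1)\<close>-st difference at \<open>x\<close>. For
  \<open>x = e (Suc j)\<close> the latter coincides with column \<open>j + 1\<close> and does not contribute.
\<close>

lemma word_poly_drag: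
  assumes "Suc j < k" "e j = Suc (e (Suc j))"
  shows "word_poly k e = word_poly k (e(j := e (Suc j)))"
proof -
  define x where "x = e (Suc j)"
  define h where "h i l = (if l = j then moment_diff i (Suc j) x else moment_diff i l (e l))" for i l
  have "word_poly k e = word_poly k (e(j := x)) + det_of k h"
    unfolding word_poly_def
    by (rule det_of_add_column[of j]) (use assms in \<open>auto simp: h_def x_def\<close>)
  also have "det_of k h = 0"
    by (rule det_of_identical_columns[of j _ "Suc j"]) (use assms in \<open>auto simp: h_def x_def\<close>)
  finally show ?thesis unfolding x_def by (simp only: add_0_right)
qed

text \<open>
  Lowering \<open>e c\<close> violates the order exactly against the letters below \<open>c\<close> whose budget equals
  \<open>e c\<close>. These form a block ending at \<open>c\<close>, and its members are dragged down one after the other,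
  from the top to the bottom.
\<close>

lemma word_poly_push:
  assumes mono: "\<And>i j. i \<le> j \<Longrightarrow> j < k \<Longrightarrow> e i \<le> e j"
    and c: "c < k" "1 \<le> e c"
  shows "word_poly k (e(c := e c - 1)) = word_poly k (push c e)"
proof -
  \<comment> \<open>the intermediate stage in which the letters from \<open>l\<close> to \<open>c\<close> have been pushed\<close>
  define f where "f l = (\<lambda>m. if l \<le> m \<and> m \<le> c then min (e m) (e c - 1) else e m)" for l
  have "word_poly k (f 0) = word_poly k (f c)"
  proof (rule inc_induct[of 0 c])
    fix l assume l: "l < c" and IH: "word_poly k (f (Suc l)) = word_poly k (f c)"
    show "word_poly k (f l) = word_poly k (f c)"
    proof (cases "e l < e c")
      case True
      then have "f l = f (Suc l)" by (auto simp: f_def fun_eq_iff le_Suc_eq not_less_eq_eq)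
      then show ?thesis using IH by simp
    next
      case False
      \<comment> \<open>\<open>l\<close> still has the old budget of \<open>c\<close>, one more than its neighbour has after its push\<close>
      then have "e l = e c" "e (Suc l) = e c"
        using mono[of l c] mono[of l "Suc l"] mono[of "Suc l" c] l c by auto
      then have *: "f (Suc l) l = Suc (f (Suc l) (Suc l))"
          and "f l = (f (Suc l))(l := f (Suc l) (Suc l))"
        using l c by (auto simp: f_def fun_eq_iff le_Suc_eq not_less_eq_eq)
      then have "word_poly k (f l) = word_poly k (f (Suc l))"
        using word_poly_drag[of l k "f (Suc l)"] l c by simp
      then show ?thesis using IH by simp
    qed
  qed auto
  moreover have "f 0 = push c e" "f c = e(c := e c - 1)"
    by (auto simp: f_def push_def fun_eq_iff)
  ultimately show ?thesis by simp
qed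

text \<open>
  The coefficients on the left and the counts on the right satisfy the same recursion in \<open>N\<close>: the
  derivative of \<open>word_poly k e\<close> shifts coefficients, and it is the sum over the possible first
  letters. For a letter with budget \<open>1\<close> the count is zero because the letter is forbidden, and the
  polynomial is zero because the push exhausts the budget.
\<close>

theorem coeff_word_poly:
  assumes "\<And>i j. i \<le> j \<Longrightarrow> j < k \<Longrightarrow> e i \<le> e j" and "\<And>j. j < k \<Longrightarrow> 1 \<le> e j"
  shows "fact N * coeff (word_poly k e) N = real (card (admissible_words k e N))"
  using assms
proof (induction N arbitrary: e)
  case 0
  then show ?case by (simp add: coeff_0_word_poly card_admissible_words_0)
next
  case (Suc N)
  note mono = Suc.prems(1) and pos = Suc.prems(2)
  have "fact (Suc N) * coeff (word_poly k e) (Suc N) = fact N * coeff (pderiv (word_poly k e)) N"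
    by (simp add: coeff_pderiv algebra_simps)
  also have "\<dots> = (\<Sum>c<k. fact N * coeff (word_poly k (push c e)) N)"
  proof -
    have "word_poly k (e(c := e c - 1)) = word_poly k (push c e)" if "c < k" for c
      using mono pos[OF that] that by (intro word_poly_push)
    then show ?thesis
      using pos by (simp add: pderiv_word_poly coeff_sum sum_distrib_left)
  qed
  also have "\<dots> = (\<Sum>c<k. real (if 2 \<le> e c then card (admissible_words k (push c e) N) else 0))"
  proof (intro sum.cong refl)
    fix c assume c: "c \<in> {..<k}"
    show "fact N * coeff (word_poly k (push c e)) N =
        real (if 2 \<le> e c then card (admissible_words k (push c e) N) else 0)"
    proof (cases "2 \<le> e c")
      case True
      have "fact N * coeff (word_poly k (push c e)) N = real (card (admissible_words k (push c e) N))"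
      proof (rule Suc.IH)
        fix i j assume ij: "i \<le> j" "j < k"
        show "push c e i \<le> push c e j"
          using mono[OF ij] mono[of c j] ij c by (auto simp: push_def min_def)
      next
        fix j assume "j < k"
        then show "1 \<le> push c e j" using pos[of j] True by (auto simp: push_def)
      qed
      then show ?thesis using True by simp
    next
      case False
      then have "push c e 0 = 0" using pos[of c] c by (auto simp: push_def)
      then have "word_poly k (push c e) = 0" using c by (intro word_poly_eq_0) auto
      then show ?thesis using False by simp
    qed
  qed
  also have "\<dots> = real (card (admissible_words k e (Suc N)))"
    by (simp add: card_admissible_words_Suc)
  finally show ?case .
qed

section \<open>Weakly increasing subsequences of random words\<close>

lemma subseq_sorted_wrt:
  assumes "subseq xs ys" "sorted_wrt P ys"
  shows "sorted_wrt P xs"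
  using assms by (induction rule: list_emb.induct) (auto dest: list_emb_set)

lemma subseq_map_upt_iff:
  "subseq ys (map f [1..<Suc N]) \<longleftrightarrow>
     (\<exists>zs. sorted_wrt (<) zs \<and> set zs \<subseteq> {1..N} \<and> ys = map f zs)"
proof
  assume "subseq ys (map f [1..<Suc N])"
  then obtain I where "ys = nths (map f [1..<Suc N]) I" by (auto simp: subseq_conv_nths)
  then have "ys = map f (nths [1..<Suc N] I)" by (simp only: nths_map)
  moreover have *: "subseq (nths [1..<Suc N] I) [1..<Suc N]"
    unfolding subseq_conv_nths by blast
  moreover have "sorted_wrt (<) (nths [1..<Suc N] I)"
    by (rule subseq_sorted_wrt[OF *]) (rule sorted_wrt_upt)
  moreover have "set (nths [1..<Suc N] I) \<subseteq> {1..N}"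
    using set_nths_subset[of "[1..<Suc N]" I] by auto
  ultimately show "\<exists>zs. sorted_wrt (<) zs \<and> set zs \<subseteq> {1..N} \<and> ys = map f zs" by blast
next
  assume "\<exists>zs. sorted_wrt (<) zs \<and> set zs \<subseteq> {1..N} \<and> ys = map f zs"
  then obtain zs where zs: "sorted_wrt (<) zs" "set zs \<subseteq> {1..N}" "ys = map f zs" by blast
  have "zs = filter (\<lambda>i. i \<in> set zs) [1..<Suc N]"
  proof (rule sorted_distinct_set_unique)
    show "set zs = set (filter (\<lambda>i. i \<in> set zs) [1..<Suc N])" using zs(2) by auto
  qed (use zs(1) in \<open>auto simp: strict_sorted_iff simp del: upt_Suc intro!: sorted_wrt_filter\<close>)
  then have "subseq zs [1..<Suc N]" by (metis subseq_filter_left)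
  then show "subseq ys (map f [1..<Suc N])" using zs(3) by (simp only: subseq_map)
qed

text \<open>
  The reversal \<open>k - w i\<close> of the alphabet maps \<open>{1..k}\<close> to \<open>{..<k}\<close> and turns weakly increasing
  into weakly decreasing. In this order the column with \<open>j\<close> differences belongs to the letter \<open>j\<close>.
\<close>

definition word_list :: "nat \<Rightarrow> nat \<Rightarrow> (nat \<Rightarrow> nat) \<Rightarrow> nat list" where
  "word_list k N w = map (\<lambda>i. k - w i) [1..<Suc N]"

text \<open>
  The positions of a subsequence form a strictly increasing list \<open>zs\<close>, which corresponds to the
  index map \<open>a \<mapsto> zs ! (a - 1)\<close> on \<open>{1..m}\<close>.
\<close>

lemma weak_incr_lengths_word_list:
  assumes "w \<in> words k N"
  shows "m \<in> weak_incr_lengths N w \<longleftrightarrow>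
    (\<exists>ys. subseq ys (word_list k N w) \<and> sorted_wrt (\<ge>) ys \<and> length ys = m)"
proof -
  have wk: "w i \<le> k" if "i \<in> {1..N}" for i
    using assms that by (auto simp: words_def PiE_def Pi_def)
  have "(\<exists>ys. subseq ys (word_list k N w) \<and> sorted_wrt (\<ge>) ys \<and> length ys = m) \<longleftrightarrow>
      (\<exists>zs. sorted_wrt (<) zs \<and> set zs \<subseteq> {1..N} \<and>
         sorted_wrt (\<ge>) (map (\<lambda>i. k - w i) zs) \<and> length zs = m)"
    unfolding word_list_def subseq_map_upt_iff by fastforce
  also have "\<dots> \<longleftrightarrow> m \<in> weak_incr_lengths N w"
  proof
    assume "\<exists>zs. sorted_wrt (<) zs \<and> set zs \<subseteq> {1..N} \<and>
         sorted_wrt (\<ge>) (map (\<lambda>i. k - w i) zs) \<and> length zs = m"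
    then obtain zs where zs: "sorted_wrt (<) zs" "set zs \<subseteq> {1..N}"
      "sorted_wrt (\<ge>) (map (\<lambda>i. k - w i) zs)" "length zs = m" by blast
    define i where "i a = zs ! (a - 1)" for a
    have mem: "i a \<in> {1..N}" if "a \<in> {1..m}" for a
    proof -
      have "i a \<in> set zs" using that zs(4) by (auto simp: i_def)
      then show ?thesis using zs(2) by blast
    qed
    have "strict_mono_on {1..m} i"
      unfolding i_def by (rule strict_mono_onI) (use zs(1,4) in \<open>auto simp: sorted_wrt_iff_nth_less\<close>)
    moreover have "mono_on {1..m} (w \<circ> i)"
    proof (rule mono_onI)
      fix a b assume ab: "a \<in> {1..m}" "b \<in> {1..m}" "a \<le> b"
      show "(w \<circ> i) a \<le> (w \<circ> i) b"
      proof (cases "a = b")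
        case False
        then have "k - w (i b) \<le> k - w (i a)"
          using ab zs(3,4) by (auto simp: sorted_wrt_iff_nth_less i_def)
        then show ?thesis using wk[OF mem[OF ab(1)]] wk[OF mem[OF ab(2)]] by auto
      qed simp
    qed
    ultimately show "m \<in> weak_incr_lengths N w"
      unfolding weak_incr_lengths_def using mem by blast
  next
    assume "m \<in> weak_incr_lengths N w"
    then obtain i where i: "i \<in> {1..m} \<rightarrow> {1..N}" "strict_mono_on {1..m} i" "mono_on {1..m} (w \<circ> i)"
      unfolding weak_incr_lengths_def by blast
    let ?zs = "map i [1..<Suc m]"
    have "sorted_wrt (<) ?zs"
      unfolding sorted_wrt_map
      by (rule sorted_wrt_mono_rel[OF _ sorted_wrt_upt]) (use i(2) in \<open>auto simp: strict_mono_on_def\<close>)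
    moreover have "set ?zs \<subseteq> {1..N}" using i(1) by auto
    moreover have "sorted_wrt (\<ge>) (map (\<lambda>i. k - w i) ?zs)"
      unfolding sorted_wrt_map
      by (rule sorted_wrt_mono_rel[OF _ sorted_wrt_upt])
         (use i(3) in \<open>auto simp: monotone_on_def intro!: diff_le_mono2\<close>)
    ultimately show "\<exists>zs. sorted_wrt (<) zs \<and> set zs \<subseteq> {1..N} \<and>
         sorted_wrt (\<ge>) (map (\<lambda>i. k - w i) zs) \<and> length zs = m"
      by (intro exI[of _ ?zs]) auto
  qed
  finally show ?thesis ..
qed

lemma longest_weak_incr_le_iff:
  assumes "w \<in> words k N"
  shows "longest_weak_incr N w \<le> n \<longleftrightarrow> admissible (\<lambda>_. Suc n) (word_list k N w)"
proof -
  have "longest_weak_incr N w \<le> n \<longleftrightarrow> (\<forall>m\<in>weak_incr_lengths N w. m \<le> n)"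
    unfolding longest_weak_incr_def
    by (rule Max_le_iff[OF finite_weak_incr_lengths]) (use zero_in_weak_incr_lengths in blast)
  also have "\<dots> \<longleftrightarrow>
      (\<forall>ys. subseq ys (word_list k N w) \<and> sorted_wrt (\<ge>) ys \<longrightarrow> length ys \<le> n)"
    unfolding Ball_def weak_incr_lengths_word_list[OF assms] by auto
  also have "\<dots> \<longleftrightarrow> admissible (\<lambda>_. Suc n) (word_list k N w)"
  proof -
    have "length ys \<le> n \<longleftrightarrow> (ys \<noteq> [] \<longrightarrow> length ys < Suc n)" for ys :: "nat list"
      by (cases ys) auto
    then show ?thesis unfolding admissible_def by blast
  qed
  finally show ?thesis .
qed

lemma bij_betw_word_list:
  "bij_betw (word_list k N) (words k N) {v. length v = N \<and> set v \<subseteq> {..<k}}"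
proof (rule bij_betw_byWitness)
  let ?g = "\<lambda>v. \<lambda>i\<in>{1..N}. k - v ! (i - 1)"
  show "\<forall>w\<in>words k N. ?g (word_list k N w) = w"
  proof
    fix w assume w: "w \<in> words k N"
    show "?g (word_list k N w) = w"
    proof
      fix i
      show "?g (word_list k N w) i = w i"
        using w by (cases "i \<in> {1..N}")
          (auto simp: words_def word_list_def PiE_def Pi_def extensional_def simp del: upt_Suc)
    qed
  qed
  show "\<forall>v\<in>{v. length v = N \<and> set v \<subseteq> {..<k}}. word_list k N (?g v) = v"
  proof
    fix v assume v: "v \<in> {v. length v = N \<and> set v \<subseteq> {..<k}}"
    show "word_list k N (?g v) = v"
    proof (rule nth_equalityI)
      fix i assume i: "i < length (word_list k N (?g v))"
      then have "v ! i \<in> set v" using v by (auto simp: word_list_def simp del: upt_Suc)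
      then have "v ! i < k" using v by auto
      then show "word_list k N (?g v) ! i = v ! i"
        using i v by (auto simp: word_list_def simp del: upt_Suc)
    qed (use v in \<open>auto simp: word_list_def\<close>)
  qed
  show "word_list k N ` words k N \<subseteq> {v. length v = N \<and> set v \<subseteq> {..<k}}"
  proof (intro image_subsetI)
    fix w assume w: "w \<in> words k N"
    have "w i \<in> {1..k}" if "i \<in> {1..N}" for i
      using w that unfolding words_def by (rule PiE_mem)
    then have "k - w i < k" if "i \<in> {1..N}" for i
      using that by force
    then show "word_list k N w \<in> {v. length v = N \<and> set v \<subseteq> {..<k}}"
      by (auto simp: word_list_def simp del: upt_Suc)
  qed
  show "?g ` {v. length v = N \<and> set v \<subseteq> {..<k}} \<subseteq> words k N"
  proof (intro image_subsetI)
    fix v assume v: "v \<in> {v. length v = N \<and> set v \<subseteq> {..<k}}"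
    have "v ! (i - 1) < k" if "i \<in> {1..N}" for i
    proof -
      have "v ! (i - 1) \<in> set v" using that v by auto
      then show ?thesis using v by auto
    qed
    then show "?g v \<in> words k N"
      unfolding words_def by (intro restrict_PiE_iff[THEN iffD2] ballI) (simp add: Suc_le_eq)
  qed
qed

lemma F_I_eq_card_admissible:
  assumes "k \<ge> 1"
  shows "F_I n k N = real (card (admissible_words k (\<lambda>_. Suc n) N)) / real k ^ N"
proof -
  have fin: "finite (words k N)" unfolding words_def by (intro finite_PiE) auto
  have card: "card (words k N) = k ^ N" unfolding words_def by (simp add: card_PiE)
  have ne: "words k N \<noteq> {}" using assms fin card by (metis card.empty power_not_zero not_one_le_zero)
  have "word_list k N ` {w \<in> words k N. longest_weak_incr N w \<le> n} =
      {v \<in> word_list k N ` words k N. admissible (\<lambda>_. Suc n) v}"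
    by (auto simp: longest_weak_incr_le_iff)
  also have "\<dots> = admissible_words k (\<lambda>_. Suc n) N"
    unfolding bij_betw_imp_surj_on[OF bij_betw_word_list[of k N]]
    by (auto simp: admissible_words_def)
  finally have "word_list k N ` {w \<in> words k N. longest_weak_incr N w \<le> n} =
      admissible_words k (\<lambda>_. Suc n) N" .
  moreover have "inj_on (word_list k N) {w \<in> words k N. longest_weak_incr N w \<le> n}"
    using bij_betw_imp_inj_on[OF bij_betw_word_list[of k N]] by (rule inj_on_subset) auto
  ultimately have eq: "card {w \<in> words k N. longest_weak_incr N w \<le> n} = card (admissible_words k (\<lambda>_. Suc n) N)"
    using card_image[of "word_list k N" "{w \<in> words k N. longest_weak_incr N w \<le> n}"] by simp
  have "words k N \<inter> {w. longest_weak_incr N w \<le> n} = {w \<in> words k N. longest_weak_incr N w \<le> n}"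
    by auto
  then show ?thesis
    unfolding F_I_def using fin ne eq by (simp add: measure_pmf_of_set card)
qed

theorem G_I_eq_word_poly:
  assumes "k \<ge> 1"
  shows "G_I n k (real k * t) = poly (word_poly k (\<lambda>_. Suc n)) t"
proof -
  let ?P = "word_poly k (\<lambda>_. Suc n)"
  have "F_I n k N * (real k * t) ^ N / fact N = coeff ?P N * t ^ N" for N
  proof -
    have "fact N * coeff ?P N = real (card (admissible_words k (\<lambda>_. Suc n) N))"
      by (rule coeff_word_poly) auto
    then show ?thesis
      unfolding F_I_eq_card_admissible[OF assms] using assms by (simp add: power_mult_distrib field_simps)
  qed
  then have "G_I n k (real k * t) = (\<Sum>N. coeff ?P N * t ^ N)"
    unfolding G_I_def by simp
  also have "\<dots> = (\<Sum>N\<le>degree ?P. coeff ?P N * t ^ N)"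
    by (rule suminf_finite) (auto simp: coeff_eq_0)
  finally show ?thesis by (simp add: poly_altdef)
qed

section \<open>The tail integral of the Laguerre ensemble\<close>

text \<open>
  The \<open>m\<close>-th forward difference of \<open>x \<mapsto> z^x / x!\<close> is divisible by \<open>z^x\<close>; this is the quotient, a
  polynomial in \<open>z\<close>. The difference at \<open>Suc x\<close> carries one more factor \<open>z\<close>, whence the recursion.
\<close>

fun power_diff_factor :: "nat \<Rightarrow> nat \<Rightarrow> real poly" where
  "power_diff_factor 0 x = [:1 / fact x:]"
| "power_diff_factor (Suc m) x = pCons 0 (power_diff_factor m (Suc x)) - power_diff_factor m x"

lemma degree_power_diff_factor: "degree (power_diff_factor m x) \<le> m"
proof (induction m arbitrary: x)
  case (Suc m)
  have "degree (pCons 0 (power_diff_factor m (Suc x))) \<le> Suc m"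
    using Suc[of "Suc x"] by (meson degree_pCons_le le_trans Suc_le_mono)
  then show ?case using Suc[of x] by (auto intro!: degree_diff_le)
qed simp

lemma coeff_power_diff_factor: "coeff (power_diff_factor m x) m = 1 / fact (x + m)"
proof (induction m arbitrary: x)
  case (Suc m)
  have "coeff (power_diff_factor m x) (Suc m) = 0"
    by (rule coeff_eq_0) (use degree_power_diff_factor[of m x] in simp)
  then show ?case using Suc[of "Suc x"] by (simp del: fact_Suc)
qed simp

lemma has_bochner_integral_Gamma:
  "has_bochner_integral lborel (\<lambda>y::real. indicator {0..} y * (y ^ q * exp (- y))) (fact q)"
proof (rule has_bochner_integral_nn_integral)
  show "AE y::real in lborel. 0 \<le> indicator {0..} y * (y ^ q * exp (- y))"
    by (auto simp: indicator_def)
  have "(\<integral>\<^sup>+ y. ennreal (indicator {0..} y * (y ^ q * exp (- y))) \<partial>lborel) =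
      (\<integral>\<^sup>+ y. ennreal (y ^ q * exp (- y)) * indicator {0..} y \<partial>lborel)"
    by (intro nn_integral_cong) (auto simp: indicator_def)
  also have "\<dots> = ennreal (fact q)"
    by (simp add: nn_intergal_power_times_exp_Ici)
  finally show "(\<integral>\<^sup>+ y. ennreal (indicator {0..} y * (y ^ q * exp (- y))) \<partial>lborel) = ennreal (fact q)" .
qed auto

lemma shifted_moment_integral:
  "has_bochner_integral lborel
     (\<lambda>y::real. indicator {0..} y * ((y + t) ^ x / fact x * (y ^ p / fact p) * exp (- y)))
     (poly (shifted_moment p (Suc x)) t)"
proof -
  define a where "a s = t ^ s / (fact s * fact (x - s) * fact p)" for s
  have *: "indicator {0..} y * ((y + t) ^ x / fact x * (y ^ p / fact p) * exp (- y)) =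
      (\<Sum>s\<le>x. a s * (indicator {0..} y * (y ^ (x - s + p) * exp (- y))))" for y :: real
  proof -
    have "(y + t) ^ x / fact x = (\<Sum>s\<le>x. t ^ s / fact s * (y ^ (x - s) / fact (x - s)))"
      unfolding add.commute[of y t] binomial_ring sum_divide_distrib
      by (intro sum.cong refl) (simp add: binomial_fact)
    then have "indicator {0..} y * ((y + t) ^ x / fact x * (y ^ p / fact p) * exp (- y)) =
        (\<Sum>s\<le>x. indicator {0..} y *
           (t ^ s / fact s * (y ^ (x - s) / fact (x - s)) * (y ^ p / fact p) * exp (- y)))"
      by (simp only: sum_distrib_left sum_distrib_right)
    also have "\<dots> = (\<Sum>s\<le>x. a s * (indicator {0..} y * (y ^ (x - s + p) * exp (- y))))"
      unfolding a_def power_add by (intro sum.cong refl) (simp add: field_simps)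
    finally show ?thesis .
  qed
  have **: "poly (shifted_moment p (Suc x)) t = (\<Sum>s\<le>x. a s * fact (x - s + p))"
    by (auto simp: poly_sum poly_monom a_def binomial_fact mult_ac intro!: sum.cong)
  show ?thesis
    unfolding * **
    by (intro has_bochner_integral_sum has_bochner_integral_mult_right has_bochner_integral_Gamma)
qed

text \<open>
  For \<open>m = 0\<close> this is the integral for the shifted moments after the substitution \<open>x = y + t\<close>, and
  differences may be taken under the integral.
\<close>

lemma moment_diff_integral:
  "has_bochner_integral lborel
     (\<lambda>x. (x - t) ^ p / fact p *
        (indicator {t..} x * (x ^ n * exp (- x)) * poly (power_diff_factor m n) x))
     (exp (- t) * poly (moment_diff p m (Suc n)) t)"
proof (induction m arbitrary: n)
  case 0
  define h where "h x = (x - t) ^ p / fact p *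
        (indicator {t..} x * (x ^ n * exp (- x)) * poly (power_diff_factor 0 n) x)" for x
  have "h (t + 1 * y) = exp (- t) *
      (indicator {0..} y * ((y + t) ^ n / fact n * (y ^ p / fact p) * exp (- y)))" for y
  proof -
    have "exp (- (t + y)) = exp (- t) * exp (- y)"
      by (simp flip: exp_add)
    then show ?thesis
      by (auto simp: h_def indicator_def add.commute mult_ac)
  qed
  then have "has_bochner_integral lborel (\<lambda>y. h (t + 1 * y))
      (exp (- t) * poly (shifted_moment p (Suc n)) t)"
    by (simp only:) (intro has_bochner_integral_mult_right shifted_moment_integral)
  then have "has_bochner_integral lborel h (exp (- t) * poly (shifted_moment p (Suc n)) t)"
    by (subst lborel_has_bochner_integral_real_affine_iff[of 1 _ _ t])
       (simp_all del: shifted_moment.simps)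
  then show ?case by (simp only: h_def[abs_def] moment_diff.simps)
next
  case (Suc m)
  from has_bochner_integral_diff[OF Suc[of "Suc n"] Suc[of n]]
  show ?case by (simp add: algebra_simps)
qed

lemma prod_pairs_reindex:
  "(\<Prod>i<k. \<Prod>j<i. F (Suc j) (Suc i)) = (\<Prod>i\<in>{1..k}. \<Prod>j\<in>{i<..k}. F i j)"
proof (induction k)
  case (Suc k)
  have "(\<Prod>j\<in>{i<..Suc k}. F i j) = F i (Suc k) * (\<Prod>j\<in>{i<..k}. F i j)" if "i \<in> {1..k}" for i
  proof -
    have "{i<..Suc k} = insert (Suc k) {i<..k}" using that by auto
    then show ?thesis by simp
  qed
  then have "(\<Prod>i\<in>{1..Suc k}. \<Prod>j\<in>{i<..Suc k}. F i j) =
      (\<Prod>i\<in>{1..k}. F i (Suc k)) * (\<Prod>i\<in>{1..k}. \<Prod>j\<in>{i<..k}. F i j)"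
    by (simp add: prod.distrib)
  then show ?case using Suc by (simp add: prod.atLeast1_atMost_eq mult.commute)
qed simp

text \<open>
  Put \<open>word_poly\<close> into Andreief's identity, with rows \<open>(x - t)^i / i!\<close> and columns
  \<open>x^n * exp (- x)\<close> times \<open>power_diff_factor j n\<close> on \<open>[t, \<infinity>)\<close>. The degrees are \<open>i\<close> and \<open>j\<close>, so
  both determinants are multiples of the Vandermonde determinant, by the products of the leading
  coefficients \<open>1 / i!\<close> and \<open>1 / (n + j)!\<close>. The positivity of \<open>n\<close> makes the integrand vanish at
  \<open>x = 0\<close>, where for \<open>t = 0\<close> the sets \<open>[t, \<infinity>)\<close> and \<open>(0, \<infinity>)\<close> differ.
\<close>

lemma laguerre_tail_integral:
  assumes "0 \<le> t" "1 \<le> n"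
  shows "has_bochner_integral (\<Pi>\<^sub>M j\<in>{1..k}. lborel)
    (\<lambda>x. (\<Prod>j\<in>{1..k}. indicator {t..} (x j)) * laguerre_weight k n x)
    (fact k * (\<Prod>i<k. fact i * fact (n + i)) *
       (exp (- (real k * t)) * poly (word_poly k (\<lambda>_. Suc n)) t))"
proof -
  define f where "f i x = (x - t) ^ i / fact i" for i and x :: real
  define w where "w x = indicator {t..} x * (x ^ n * exp (- x))" for x :: real
  define g where "g j x = w x * poly (power_diff_factor j n) x" for j x
  \<comment> \<open>the inverse of the product of all leading coefficients of the two determinants\<close>
  define K :: real where "K = (\<Prod>i<k. fact i * fact (n + i))"
  have K: "K \<noteq> 0" by (simp add: K_def)
  have I: "has_bochner_integral lborel (\<lambda>x. f i x * g j x)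
      (exp (- t) * poly (moment_diff i j (Suc n)) t)" for i j
    unfolding f_def g_def w_def by (rule moment_diff_integral)
  have "has_bochner_integral (\<Pi>\<^sub>M j\<in>{1..k}. lborel)
    (\<lambda>x. det_of k (\<lambda>l i. f i (x (Suc l))) * det_of k (\<lambda>l j. g j (x (Suc l))))
    (fact k * det_of k (\<lambda>i j. LINT x|lborel. f i x * g j x))"
    by (rule andreief[OF sigma_finite_lborel]) (rule integrable.intros[OF I])
  then have "has_bochner_integral (\<Pi>\<^sub>M j\<in>{1..k}. lborel)
    (\<lambda>x. K * (det_of k (\<lambda>l i. f i (x (Suc l))) * det_of k (\<lambda>l j. g j (x (Suc l)))))
    (K * (fact k * det_of k (\<lambda>i j. LINT x|lborel. f i x * g j x)))"
    by (rule has_bochner_integral_mult_right)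
  also have "(\<lambda>x. K * (det_of k (\<lambda>l i. f i (x (Suc l))) * det_of k (\<lambda>l j. g j (x (Suc l))))) =
      (\<lambda>x. (\<Prod>j\<in>{1..k}. indicator {t..} (x j)) * laguerre_weight k n x)"
  proof
    fix x :: "nat \<Rightarrow> real"
    define V where "V = det_of k (\<lambda>l j. x (Suc l) ^ j)"
    have lin: "degree ([:- t, 1:] ^ j) = j" "coeff ([:- t, 1:] ^ j) j = 1" for j
      by (simp_all add: degree_linear_power coeff_linear_power)
    have "det_of k (\<lambda>l i. f i (x (Suc l))) =
        det_of k (\<lambda>l i. poly (Polynomial.smult (1 / fact i) ([:- t, 1:] ^ i)) (x (Suc l)))"
      by (simp add: f_def)
    also have "\<dots> = V * (\<Prod>i<k. 1 / fact i)"
      unfolding V_def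
      by (subst det_of_polynomials) (auto simp: lin)
    finally have f: "det_of k (\<lambda>l i. f i (x (Suc l))) = V * (\<Prod>i<k. 1 / fact i)" .
    have g: "det_of k (\<lambda>l j. g j (x (Suc l))) =
        (\<Prod>l<k. w (x (Suc l))) * (V * (\<Prod>j<k. 1 / fact (n + j)))"
      unfolding g_def V_def det_of_scale_rows
      by (subst det_of_polynomials) (auto simp: degree_power_diff_factor coeff_power_diff_factor)
    have V: "V * V = (\<Prod>i\<in>{1..k}. \<Prod>j\<in>{i<..k}. (x i - x j)\<^sup>2)"
      unfolding V_def vandermonde[of k "\<lambda>l. x (Suc l)"] prod.distrib[symmetric]
        power2_eq_square[symmetric]
      using prod_pairs_reindex[of "\<lambda>i j. (x j - x i)\<^sup>2" k]
      by (simp add: prod_power_distrib power2_commute[of "x a" "x b" for a b])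
    have w: "(\<Prod>l<k. w (x (Suc l))) = (\<Prod>j\<in>{1..k}. indicator {t..} (x j)) *
        (\<Prod>j\<in>{1..k}. indicator {0<..} (x j) * x j ^ n * exp (- x j))"
    proof -
      have "w y = indicator {t..} y * (indicator {0<..} y * y ^ n * exp (- y))" for y
        using assms by (auto simp: w_def indicator_def)
      then show ?thesis by (simp add: prod.atLeast1_atMost_eq prod.distrib)
    qed
    have KK: "K * ((\<Prod>i<k. 1 / fact i) * (\<Prod>j<k. 1 / fact (n + j))) = 1"
      unfolding K_def prod.distrib[symmetric] by (rule prod.neutral) simp
    have "K * (det_of k (\<lambda>l i. f i (x (Suc l))) * det_of k (\<lambda>l j. g j (x (Suc l)))) =
        (K * ((\<Prod>i<k. 1 / fact i) * (\<Prod>j<k. 1 / fact (n + j)))) *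
        ((\<Prod>l<k. w (x (Suc l))) * (V * V))"
      unfolding f g by (simp only: mult_ac)
    also have "\<dots> = (\<Prod>j\<in>{1..k}. indicator {t..} (x j)) * laguerre_weight k n x"
      unfolding KK V w laguerre_weight_def by (simp only: mult_ac mult_1_left)
    finally show "K * (det_of k (\<lambda>l i. f i (x (Suc l))) * det_of k (\<lambda>l j. g j (x (Suc l)))) =
        (\<Prod>j\<in>{1..k}. indicator {t..} (x j)) * laguerre_weight k n x" .
  qed
  also have "det_of k (\<lambda>i j. LINT x|lborel. f i x * g j x) =
      exp (- (real k * t)) * poly (word_poly k (\<lambda>_. Suc n)) t"
    unfolding has_bochner_integral_integral_eq[OF I] det_of_scale_rows word_poly_def
      det_of_hom[OF comm_ring_hom_poly]
    by (simp add: exp_of_nat_mult[symmetric])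
  finally show ?thesis by (simp only: K_def mult_ac)
qed

text \<open>
  The case \<open>t = 0\<close> of the tail integral, where the indicators are redundant and \<open>word_poly\<close> has
  the value \<open>1\<close>, the contribution of the empty word.
\<close>

lemma laguerre_normalization:
  assumes "1 \<le> n"
  shows "laguerre_const k n = 1 / (fact k * (\<Prod>i<k. fact i * fact (n + i)))"
    and "integrable (\<Pi>\<^sub>M j\<in>{1..k}. lborel) (laguerre_weight k n)"
proof -
  have "(\<Prod>j\<in>{1..k}. indicator {0..} (x j)) * laguerre_weight k n x = laguerre_weight k n x" for x
  proof -
    have "(\<Prod>j\<in>{1..k}. indicator {0..} (x j) :: real) *
        (\<Prod>j\<in>{1..k}. indicator {0<..} (x j) * x j ^ n * exp (- x j)) =
        (\<Prod>j\<in>{1..k}. indicator {0<..} (x j) * x j ^ n * exp (- x j))"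
      unfolding prod.distrib[symmetric] by (intro prod.cong refl) (auto simp: indicator_def)
    then show ?thesis unfolding laguerre_weight_def by (simp only: mult.assoc[symmetric])
  qed
  then have *: "has_bochner_integral (\<Pi>\<^sub>M j\<in>{1..k}. lborel) (laguerre_weight k n)
      (fact k * (\<Prod>i<k. fact i * fact (n + i)))"
    using laguerre_tail_integral[of 0 n k] assms
    by (simp only: coeff_0_word_poly poly_0_coeff_0 mult_zero_right minus_zero exp_zero mult_1_right
        order_refl One_nat_def le_add1 Suc_le_mono zero_le)
  then show "laguerre_const k n = 1 / (fact k * (\<Prod>i<k. fact i * fact (n + i)))"
    and "integrable (\<Pi>\<^sub>M j\<in>{1..k}. lborel) (laguerre_weight k n)"
    unfolding laguerre_const_def has_bochner_integral_iff by auto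
qed

lemma prob_lambda_min_ge:
  assumes "1 \<le> k" "1 \<le> n" "0 \<le> t"
  shows "\<P>(x in laguerre_ensemble k n. lambda_min k x \<ge> t) =
    exp (- (real k * t)) * poly (word_poly k (\<lambda>_. Suc n)) t"
proof -
  let ?M = "\<Pi>\<^sub>M j\<in>{1..k}. (lborel :: real measure)"
  define c where "c = laguerre_const k n"
  define A where "A = {x \<in> space ?M. \<forall>j\<in>{1..k}. t \<le> x j}"
  define J where "J x = (\<Prod>j\<in>{1..k}. indicator {t..} (x j)) * laguerre_weight k n x" for x
  define v where "v = exp (- (real k * t)) * poly (word_poly k (\<lambda>_. Suc n)) t"
  have c: "c = 1 / (fact k * (\<Prod>i<k. fact i * fact (n + i)))"
    unfolding c_def by (rule laguerre_normalization) fact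
  have c0: "0 \<le> c" unfolding c by (simp add: prod_nonneg)
  have meas [measurable]: "laguerre_weight k n \<in> borel_measurable ?M"
    by (rule borel_measurable_integrable) (rule laguerre_normalization(2)[OF assms(2)])
  have A [measurable]: "A \<in> sets ?M" unfolding A_def by measurable
  have nonneg: "0 \<le> laguerre_weight k n x" for x
  proof -
    have "0 \<le> indicator {0<..} y * y ^ n * exp (- y)" for y :: real
      by (cases "0 < y") auto
    then show ?thesis
      unfolding laguerre_weight_def
      by (intro mult_nonneg_nonneg[OF prod_nonneg prod_nonneg] prod_nonneg ballI zero_le_power2)
  qed
  have J0: "0 \<le> c * J x" for x
    unfolding J_def using c0 nonneg[of x] by (intro mult_nonneg_nonneg prod_nonneg) auto
  have "has_bochner_integral ?M J (fact k * (\<Prod>i<k. fact i * fact (n + i)) * v)"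
    unfolding J_def v_def by (rule laguerre_tail_integral) fact+
  from has_bochner_integral_mult_right[OF this, of c]
  have J: "has_bochner_integral ?M (\<lambda>x. c * J x) v"
    by (simp add: c)
  have "{x \<in> space (laguerre_ensemble k n). lambda_min k x \<ge> t} = A"
    using assms(1) by (auto simp: laguerre_ensemble_def A_def lambda_min_def space_density)
  then have *: "\<P>(x in laguerre_ensemble k n. lambda_min k x \<ge> t) = measure (laguerre_ensemble k n) A"
    by simp
  have "emeasure (laguerre_ensemble k n) A =
      (\<integral>\<^sup>+ x. ennreal (c * laguerre_weight k n x) * indicator A x \<partial>?M)"
    unfolding laguerre_ensemble_def c_def[symmetric] by (rule emeasure_density) measurable
  also have "\<dots> = (\<integral>\<^sup>+ x. ennreal (c * J x) \<partial>?M)"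
  proof (rule nn_integral_cong)
    fix x assume x: "x \<in> space ?M"
    show "ennreal (c * laguerre_weight k n x) * indicator A x = ennreal (c * J x)"
    proof (cases "x \<in> A")
      case True
      then have "J x = laguerre_weight k n x" by (simp add: J_def A_def indicator_def)
      then show ?thesis using True by simp
    next
      case False
      then have "(\<Prod>j\<in>{1..k}. indicator {t..} (x j) :: real) = 0"
        using x by (auto simp: A_def indicator_def)
      then have "J x = 0" by (simp only: J_def mult_zero_left)
      then show ?thesis using False by simp
    qed
  qed
  also have "\<dots> = ennreal v"
    using J J0 by (subst nn_integral_eq_integral) (auto simp: has_bochner_integral_iff)
  finally have "emeasure (laguerre_ensemble k n) A = ennreal v" .
  moreover have "0 \<le> v"
    unfolding has_bochner_integral_integral_eq[OF J, symmetric]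
    by (rule Bochner_Integration.integral_nonneg) (rule J0)
  ultimately show ?thesis
    unfolding * v_def by (simp add: measure_def)
qed

theorem theorem3:
  fixes k n :: nat and t :: real
  assumes "k \<ge> 1" and "n \<ge> 1" and "t \<ge> 0"
  shows "G_I n k (real k * t) =
    exp (real k * t) * \<P>(x in laguerre_ensemble k n. lambda_min k x \<ge> t)"
  unfolding G_I_eq_word_poly[OF assms(1)] prob_lambda_min_ge[OF assms]
  by (simp flip: mult.assoc exp_add)

end
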